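(* Let $I,J$ be nonempty subsets of $(0,+\infty)$ and let $f:I\to J$ be a bijective function with inverse function $f^*:J\to I$. Suppose that the function $g(x)=\frac{f(x)}{x}$, $x\in I$, is strictly increasing. Then for any $x\in I$, $y\in J$ such that $f(x)\ge y$ one has $$f(x)\,f^*(y)\ge xy .$$ Under the same conditions on $f$, for any $x\in I$, $y\in J$ such that $f(x)\le y$ one has the reverse inequality $$f(x)\,f^*(y)\le xy .$$ *)

theory Defs
  imports Complex_Main
begin

end

(* Since f x = x * (f x / x) is a product of positive increasing functions, f is itself strictly
   increasing. So for y = f z, comparing f x with y amounts to comparing x with z, hence
   f x / x with f z / z; clearing denominators gives the claim. *)
theory Submission
  imports Defs
begin

lemma strict_mono_on_if_ratio_strict_mono_on:
  fixes I :: "real set" and f :: "real \<Rightarrow> real"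
  assumes I: "I \<subseteq> {0<..}" and fI: "f ` I \<subseteq> {0<..}"
    and mono: "strict_mono_on I (\<lambda>x. f x / x)"
  shows "strict_mono_on I f"
proof (rule strict_mono_onI)
  fix x z assume xz: "x \<in> I" "z \<in> I" "x < z"
  have pos: "0 < x" "0 < z" "0 < f x"
    using I fI xz by auto
  have "f x / x < f z / z"
    using strict_mono_onD[OF mono] xz by blast
  \<comment> \<open>Multiplying the strict inequalities is sound because \<open>z\<close> is
    positive and \<open>f x / x\<close> is nonnegative.\<close>
  with pos xz have "x * (f x / x) < z * (f z / z)"
    by (intro mult_strict_mono) auto
  with pos show "f x < f z" by simp
qed

text \<open>Writing \<open>y\<close> as \<open>f z\<close> removes the inverse function, so both
  halves of the theorem become instances of this one inequality, with the two points
  exchanged.\<close>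

lemma ratio_cross_mult_le:
  fixes I :: "real set" and f :: "real \<Rightarrow> real"
  assumes I: "I \<subseteq> {0<..}" and fI: "f ` I \<subseteq> {0<..}"
    and mono: "strict_mono_on I (\<lambda>x. f x / x)"
    and xz: "x \<in> I" "z \<in> I" and le: "f x \<le> f z"
  shows "f x * z \<le> x * f z"
proof -
  \<comment> \<open>On a linear order a strictly increasing map also reflects \<le>.\<close>
  have "x \<le> z"
    using strict_mono_on_less_eq[OF strict_mono_on_if_ratio_strict_mono_on[OF I fI mono]] xz le
    by blast
  then have "f x / x \<le> f z / z"
    using strict_mono_on_leD[OF mono] xz by blast
  moreover have "0 < x" "0 < z" using I xz by auto
  ultimately show ?thesis by (simp add: field_simps)
qed

theorem theorem5p1:
  fixes I J :: "real set" and f :: "real \<Rightarrow> real"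
  assumes "I \<noteq> {}" and "J \<noteq> {}"
    and "I \<subseteq> {0<..}" and "J \<subseteq> {0<..}"
    and "bij_betw f I J"
    and "strict_mono_on I (\<lambda>x. f x / x)"
  shows "(\<forall>x\<in>I. \<forall>y\<in>J. f x \<ge> y \<longrightarrow> f x * inv_into I f y \<ge> x * y) \<and>
         (\<forall>x\<in>I. \<forall>y\<in>J. f x \<le> y \<longrightarrow> f x * inv_into I f y \<le> x * y)"
proof -
  have J: "J = f ` I"
    using assms(5) by (simp add: bij_betw_def)
  have inv: "inv_into I f y \<in> I" "f (inv_into I f y) = y" if "y \<in> J" for y
    using that by (simp_all add: J inv_into_into f_inv_into_f)
  note le = ratio_cross_mult_le[OF assms(3) assms(4)[unfolded J] assms(6)]
  show ?thesis
  proof (intro conjI ballI impI)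
    fix x y assume "x \<in> I" "y \<in> J" "y \<le> f x"
    \<comment> \<open>The preimage of \<open>y\<close> is now the point with the smaller value, so
      it comes first in \<open>le\<close>.\<close>
    then show "x * y \<le> f x * inv_into I f y"
      using le[of "inv_into I f y" x] inv[of y] by (simp add: mult.commute)
  next
    fix x y assume "x \<in> I" "y \<in> J" "f x \<le> y"
    then show "f x * inv_into I f y \<le> x * y"
      using le[of x "inv_into I f y"] inv[of y] by simp
  qed
qed

end
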